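(* Let $G$ be a unique product group and suppose $S$ is a strongly $G$-graded ring with $R=S_e$. Let $I$ be a $G$-invariant ideal of $R$. Then the following are equivalent. (1) $I$ is $S$-prime, i.e. $IS$ is a prime ideal of $S$. (2) If $a,b\in R$ and $S_g\,a\,S_{(hg)^{-1}}\,b\,S_h\subseteq I$ for all $g,h\in G$, then $a\in I$ or $b\in I$. (3) If $A,B$ are $G$-invariant ideals of $R$ and $AB\subseteq I$, then $A\subseteq I$ or $B\subseteq I$.
   Context: Rings have $1$, ideals are two-sided. A unique product group is a group $G$ (identity $e$) such that whenever $X,Y$ are nonempty finite subsets of $G$, there exist $x\in X$, $y\in Y$ with $xy\ne x'y'$ for every pair $(x',y')\in X\times Y$ different from $(x,y)$. A $G$-graded ring is a ring $S=\bigoplus_{g\in G}S_g$ with $S_gS_h\subseteq S_{gh}$ and $1\in S_e$; it is strongly graded if $S_gS_h=S_{gh}$ for all $g,h\in G$. For an ideal $I$ of $R=S_e$ and $g\in G$, $I^g=S_gIS_{g^{-1}}$ (an ideal of $R$). $I$ is $G$-invariant if $I^g=I$ for all $g\in G$; then $IS$ is an ideal of $S$.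
   Formalization: The ideal I is assumed proper (I ≠ R), because prime ideals are taken to be proper: for I = R, conditions (2) and (3) hold trivially while IS = S is not a prime ideal, so the equivalence fails in that case. *)

theory Defs
  imports "HOL-Algebra.Ideal_Product"
begin

definition unique_product_group :: "('g, 'm) monoid_scheme \<Rightarrow> bool" where
  "unique_product_group G \<longleftrightarrow> group G \<and>
     (\<forall>X Y. X \<subseteq> carrier G \<longrightarrow> Y \<subseteq> carrier G \<longrightarrow> finite X \<longrightarrow> finite Y \<longrightarrow> X \<noteq> {} \<longrightarrow> Y \<noteq> {} \<longrightarrow>
        (\<exists>x\<in>X. \<exists>y\<in>Y. \<forall>x'\<in>X. \<forall>y'\<in>Y. (x', y') \<noteq> (x, y) \<longrightarrow> x \<otimes>\<^bsub>G\<^esub> y \<noteq> x' \<otimes>\<^bsub>G\<^esub> y'))"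

text \<open>
  Throughout, the product of two subsets of a ring is \<^const>\<open>ideal_prod\<close>, the set of
  all nonempty finite sums of products. For a subset closed under negation, such as an additive
  subgroup, times an arbitrary nonempty set, this is the additive subgroup generated by the products.

  A grading is a family \<open>D\<close> of additive subgroups indexed by \<open>carrier G\<close>; its values
  outside \<open>carrier G\<close> are irrelevant. In \<open>direct_sum\<close>, the extensional function
  \<open>f\<close> is the family of homogeneous components of \<open>s\<close>.
\<close>

locale graded_ring = group G + ring S
  for G :: "('g, 'm) monoid_scheme" and S :: "('s, 'n) ring_scheme" +
  fixes D :: "'g \<Rightarrow> 's set"
  assumes additive_subgroup_component: "g \<in> carrier G \<Longrightarrow> additive_subgroup (D g) S"
    and direct_sum: "s \<in> carrier S \<Longrightarrow>
      \<exists>!f. f \<in> (\<Pi>\<^sub>E g\<in>carrier G. D g) \<and> finite {g \<in> carrier G. f g \<noteq> \<zero>\<^bsub>S\<^esub>} \<and>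
           s = finsum S f {g \<in> carrier G. f g \<noteq> \<zero>\<^bsub>S\<^esub>}"
    and graded_mult: "\<lbrakk>g \<in> carrier G; h \<in> carrier G\<rbrakk> \<Longrightarrow>
      ideal_prod S (D g) (D h) \<subseteq> D (g \<otimes>\<^bsub>G\<^esub> h)"
    and graded_one: "\<one>\<^bsub>S\<^esub> \<in> D \<one>\<^bsub>G\<^esub>"

locale strongly_graded_ring = graded_ring +
  assumes strongly_graded: "\<lbrakk>g \<in> carrier G; h \<in> carrier G\<rbrakk> \<Longrightarrow>
      ideal_prod S (D g) (D h) = D (g \<otimes>\<^bsub>G\<^esub> h)"

definition base_ring ::
    "('g, 'm) monoid_scheme \<Rightarrow> ('s, 'n) ring_scheme \<Rightarrow> ('g \<Rightarrow> 's set) \<Rightarrow> ('s, 'n) ring_scheme" where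
  "base_ring G S D = S\<lparr>carrier := D \<one>\<^bsub>G\<^esub>\<rparr>"

definition conj_ideal ::
    "('g, 'm) monoid_scheme \<Rightarrow> ('s, 'n) ring_scheme \<Rightarrow> ('g \<Rightarrow> 's set) \<Rightarrow> 's set \<Rightarrow> 'g \<Rightarrow> 's set" where
  "conj_ideal G S D I g = ideal_prod S (ideal_prod S (D g) I) (D (inv\<^bsub>G\<^esub> g))"

definition invariant_ideal ::
    "('g, 'm) monoid_scheme \<Rightarrow> ('s, 'n) ring_scheme \<Rightarrow> ('g \<Rightarrow> 's set) \<Rightarrow> 's set \<Rightarrow> bool" where
  "invariant_ideal G S D I \<longleftrightarrow>
     ideal I (base_ring G S D) \<and> (\<forall>g\<in>carrier G. conj_ideal G S D I g = I)"

text \<open>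
  The locale \<^locale>\<open>primeideal\<close> is restricted to commutative rings; the following is
  the usual notion for arbitrary rings.
\<close>

definition prime_ideal :: "'s set \<Rightarrow> ('s, 'n) ring_scheme \<Rightarrow> bool" where
  "prime_ideal P S \<longleftrightarrow> ideal P S \<and> P \<noteq> carrier S \<and>
     (\<forall>A B. ideal A S \<longrightarrow> ideal B S \<longrightarrow> ideal_prod S A B \<subseteq> P \<longrightarrow> A \<subseteq> P \<or> B \<subseteq> P)"

definition S_prime :: "('s, 'n) ring_scheme \<Rightarrow> 's set \<Rightarrow> bool" where
  "S_prime S I \<longleftrightarrow> prime_ideal (ideal_prod S I (carrier S)) S"

end

theory Submission
  imports Defs "HOL-Algebra.Subrings"
begin

text \<open>
  Since \<open>1\<close> lies in \<open>S\<^sub>k S\<^bsub>k\<inverse>\<^esub>\<close>, condition (2) says that \<open>a S b \<subseteq> I S\<close>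
  implies \<open>a \<in> I\<close> or \<open>b \<in> I\<close> for \<open>a, b \<in> R\<close>. Invariant ideals \<open>A\<close> of \<open>R\<close> extend to
  ideals \<open>A S\<close> of \<open>S\<close> with \<open>A S \<inter> R = A\<close>, which gives (1) to (3), and
  ideals \<open>J\<close> of \<open>S\<close> restrict to invariant ideals \<open>J \<inter> R\<close>, which gives (3) to (2) on taking
  for \<open>J\<close> the ideals generated by \<open>a\<close> and by \<open>b\<close>.

  The unique product property is needed only for (2) to (1). Suppose \<open>A B \<subseteq> P = I S\<close> with
  \<open>A\<close>, \<open>B\<close> not contained in \<open>P\<close>. Choose \<open>x \<in> A - P\<close> with as few components outside \<open>P\<close> as
  possible and any \<open>y \<in> B - P\<close>. If \<open>x\<^sub>g r y\<^sub>h \<in> P\<close> with \<open>r\<close> homogeneous and \<open>x\<^sub>g \<notin> P\<close>, then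
  \<open>x r y\<^sub>h \<in> A\<close> has fewer components outside \<open>P\<close> than \<open>x\<close>, so it lies in \<open>P\<close>. A unique
  product in the supports of \<open>x\<close> and \<open>r y\<close> yields such a pair from \<open>x r y \<in> P\<close>; it follows
  that all \<open>x\<^sub>g r y\<^sub>h\<close> are in \<open>P\<close>. Homogeneous components outside \<open>P\<close> are then moved
  to degree \<open>e\<close>, where they contradict (2).
\<close>

section \<open>Finite sums in additive subgroups and products of subsets of a ring\<close>

lemma (in additive_subgroup) finsum_mem:
  assumes "abelian_monoid G" "f \<in> A \<rightarrow> H"
  shows "finsum G f A \<in> H"
proof -
  interpret abelian_monoid G by fact
  show ?thesis using assms(2)
  proof (induction A rule: infinite_finite_induct)
    case (insert x F)
    then have "f \<in> F \<rightarrow> carrier G" "f x \<in> H"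
      by (auto simp: Pi_iff)
    with insert show ?case by (simp add: finsum_insert Pi_iff)
  qed (simp_all add: finsum_infinite finsum_empty)
qed

text \<open>The remaining term is the whole sum minus the other terms. This isolates one product
  modulo an ideal when all competing products already lie in it.\<close>

lemma (in additive_subgroup) finsum_mem_cancel:
  assumes "abelian_group G" "finite A" "i \<in> A" "f \<in> A \<rightarrow> carrier G"
    and "finsum G f A \<in> H" "\<And>j. \<lbrakk>j \<in> A; j \<noteq> i\<rbrakk> \<Longrightarrow> f j \<in> H"
  shows "f i \<in> H"
proof -
  interpret abelian_group G by fact
  have f: "f i \<in> carrier G" using assms by auto
  have rest: "finsum G f (A - {i}) \<in> H"
    by (rule finsum_mem) (use assms in \<open>auto intro: abelian_monoid_axioms\<close>)
  have "finsum G f (insert i (A - {i})) = f i \<oplus>\<^bsub>G\<^esub> finsum G f (A - {i})"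
    by (rule finsum_insert) (use assms in auto)
  then have "finsum G f A = f i \<oplus>\<^bsub>G\<^esub> finsum G f (A - {i})"
    using \<open>i \<in> A\<close> by (simp add: insert_absorb)
  then have "f i = finsum G f A \<oplus>\<^bsub>G\<^esub> (\<ominus>\<^bsub>G\<^esub> finsum G f (A - {i}))"
    using f rest by (simp add: a_assoc r_neg)
  then show ?thesis using rest assms by simp
qed

text \<open>Elements of \<open>ideal_prod\<close> are nonempty finite sums of products, so induction
  asks only for the products and closure under addition.\<close>

lemma ideal_prod_subset:
  assumes "\<And>i j. \<lbrakk>i \<in> I; j \<in> J\<rbrakk> \<Longrightarrow> i \<otimes>\<^bsub>R\<^esub> j \<in> T"
    and "\<And>s t. \<lbrakk>s \<in> T; t \<in> T\<rbrakk> \<Longrightarrow> s \<oplus>\<^bsub>R\<^esub> t \<in> T"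
  shows "ideal_prod R I J \<subseteq> T"
proof
  fix s assume "s \<in> ideal_prod R I J"
  then show "s \<in> T" by induction (auto intro: assms)
qed

lemma (in ring) ideal_prod_carrier:
  "\<lbrakk>I \<subseteq> carrier R; J \<subseteq> carrier R\<rbrakk> \<Longrightarrow> ideal_prod R I J \<subseteq> carrier R"
  by (rule ideal_prod_subset) auto

text \<open>Distributivity moves the outer factor \<open>x\<close> into each summand of
  \<open>z\<close>. Nested products are taken apart with this rule, one layer at a time.\<close>

lemma (in ring) ideal_prod_mult_mem:
  assumes "I \<subseteq> carrier R" "J \<subseteq> carrier R" "x \<in> carrier R"
    and "\<And>s t. \<lbrakk>s \<in> T; t \<in> T\<rbrakk> \<Longrightarrow> s \<oplus> t \<in> T"
    and "z \<in> ideal_prod R I J"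
  shows "(\<And>i j. \<lbrakk>i \<in> I; j \<in> J\<rbrakk> \<Longrightarrow> x \<otimes> (i \<otimes> j) \<in> T) \<Longrightarrow> x \<otimes> z \<in> T"
    and "(\<And>i j. \<lbrakk>i \<in> I; j \<in> J\<rbrakk> \<Longrightarrow> (i \<otimes> j) \<otimes> x \<in> T) \<Longrightarrow> z \<otimes> x \<in> T"
proof -
  note in_carr = subsetD[OF ideal_prod_carrier[OF assms(1,2)]]
  show "x \<otimes> z \<in> T" if *: "\<And>i j. \<lbrakk>i \<in> I; j \<in> J\<rbrakk> \<Longrightarrow> x \<otimes> (i \<otimes> j) \<in> T"
    using assms(5) by induction (use assms(3,4) * in_carr in \<open>simp_all add: r_distr\<close>)
  show "z \<otimes> x \<in> T" if *: "\<And>i j. \<lbrakk>i \<in> I; j \<in> J\<rbrakk> \<Longrightarrow> (i \<otimes> j) \<otimes> x \<in> T"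
    using assms(5) by induction (use assms(3,4) * in_carr in \<open>simp_all add: l_distr\<close>)
qed

subsection \<open>Homogeneous components\<close>

context graded_ring
begin

lemma monoid_G: "monoid G"
  by (rule group.is_monoid[OF group_axioms])

lemmas G_closed [simp] =
  monoid.one_closed[OF monoid_G] monoid.m_closed[OF monoid_G] group.inv_closed[OF group_axioms]

lemmas G_simps [simp] =
  monoid.l_one[OF monoid_G] monoid.r_one[OF monoid_G]
  group.l_inv[OF group_axioms] group.r_inv[OF group_axioms] group.inv_inv[OF group_axioms]

lemmas G_assoc = monoid.m_assoc[OF monoid_G]

lemma D_carrier: "\<lbrakk>x \<in> D g; g \<in> carrier G\<rbrakk> \<Longrightarrow> x \<in> carrier S"
  using additive_subgroup.a_Hcarr[OF additive_subgroup_component] .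

lemma D_subset: "g \<in> carrier G \<Longrightarrow> D g \<subseteq> carrier S"
  using D_carrier by blast

lemma D_add: "\<lbrakk>x \<in> D g; y \<in> D g; g \<in> carrier G\<rbrakk> \<Longrightarrow> x \<oplus>\<^bsub>S\<^esub> y \<in> D g"
  using additive_subgroup.a_closed[OF additive_subgroup_component] .

lemma D_zero: "g \<in> carrier G \<Longrightarrow> \<zero>\<^bsub>S\<^esub> \<in> D g"
  using additive_subgroup.zero_closed[OF additive_subgroup_component] .

lemma D_mult:
  "\<lbrakk>x \<in> D g; y \<in> D h; g \<in> carrier G; h \<in> carrier G\<rbrakk> \<Longrightarrow> x \<otimes>\<^bsub>S\<^esub> y \<in> D (g \<otimes>\<^bsub>G\<^esub> h)"
  by (rule subsetD[OF graded_mult ideal_prod.prod])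

text \<open>The description repeats the body of \<open>direct_sum\<close>, so it is well defined for
  \<open>s\<close> in \<open>carrier S\<close> and unspecified elsewhere.\<close>

definition component :: "'s \<Rightarrow> 'g \<Rightarrow> 's" where
  "component s = (THE f. f \<in> (\<Pi>\<^sub>E g\<in>carrier G. D g) \<and> finite {g \<in> carrier G. f g \<noteq> \<zero>\<^bsub>S\<^esub>} \<and>
     s = finsum S f {g \<in> carrier G. f g \<noteq> \<zero>\<^bsub>S\<^esub>})"

abbreviation degrees :: "'s \<Rightarrow> 'g set" where
  "degrees s \<equiv> {g \<in> carrier G. component s g \<noteq> \<zero>\<^bsub>S\<^esub>}"

lemma component_spec:
  assumes "s \<in> carrier S"
  shows "component s \<in> (\<Pi>\<^sub>E g\<in>carrier G. D g) \<and> finite (degrees s) \<and>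
     s = finsum S (component s) (degrees s)"
  by (fact theI'[OF direct_sum[OF assms], folded component_def])

lemma component_mem: "\<lbrakk>s \<in> carrier S; g \<in> carrier G\<rbrakk> \<Longrightarrow> component s g \<in> D g"
  using component_spec by (meson PiE_mem)

lemma component_carrier [simp]: "\<lbrakk>s \<in> carrier S; g \<in> carrier G\<rbrakk> \<Longrightarrow> component s g \<in> carrier S"
  using component_mem D_carrier by blast

lemma finite_degrees: "s \<in> carrier S \<Longrightarrow> finite (degrees s)"
  using component_spec by blast

text \<open>Allowing any finite superset of the support lets two elements be expanded over a common
  index set.\<close>

lemma finsum_component:
  assumes s: "s \<in> carrier S" and F: "finite F" "F \<subseteq> carrier G" "degrees s \<subseteq> F"
  shows "finsum S (component s) F = s"
proof -
  have "component s \<in> F \<rightarrow> carrier S"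
    using s F(2) component_carrier by blast
  moreover have "component s g = \<zero>\<^bsub>S\<^esub>" if "g \<in> F - degrees s" for g
    using that F(2) by blast
  ultimately have "finsum S (component s) F = finsum S (component s) (degrees s)"
    using add.finprod_mono_neutral_cong_right[OF F(1,3), of "component s" "component s"] by blast
  also have "\<dots> = s"
    using component_spec[OF s] by (elim conjE) (rule sym)
  finally show ?thesis .
qed

lemma component_unique:
  assumes F: "finite F" "F \<subseteq> carrier G" and f: "\<And>g. g \<in> F \<Longrightarrow> f g \<in> D g"
    and g: "g \<in> carrier G"
  shows "component (finsum S f F) g = (if g \<in> F then f g else \<zero>\<^bsub>S\<^esub>)"
proof -
  \<comment> \<open>Extending \<open>f\<close> by zero yields an extensional family on all of
    \<open>carrier G\<close>, the shape for which \<open>direct_sum\<close> asserts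
    uniqueness.\<close>
  define f' where "f' = (\<lambda>g\<in>carrier G. if g \<in> F then f g else \<zero>\<^bsub>S\<^esub>)"
  let ?N = "{g \<in> carrier G. f' g \<noteq> \<zero>\<^bsub>S\<^esub>}"
  have fc: "f \<in> F \<rightarrow> carrier S" using f F D_carrier by blast
  have N: "?N \<subseteq> F" by (auto simp: f'_def split: if_splits)
  have "finsum S f' ?N = finsum S f F"
    by (rule add.finprod_mono_neutral_cong_left) (use F N fc in \<open>auto simp: f'_def\<close>)
  moreover have "f' \<in> (\<Pi>\<^sub>E g\<in>carrier G. D g)"
    using f D_zero by (auto simp: f'_def)
  moreover have "finite ?N" using N F finite_subset by blast
  moreover have "finsum S f F \<in> carrier S" using fc by simp
  ultimately have "component (finsum S f F) = f'"
    unfolding component_def by (intro the1_equality[OF direct_sum] conjI) (assumption | rule sym, assumption)+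
  then show ?thesis using g by (simp add: f'_def)
qed

lemma component_add:
  assumes s: "s \<in> carrier S" and t: "t \<in> carrier S" and g: "g \<in> carrier G"
  shows "component (s \<oplus>\<^bsub>S\<^esub> t) g = component s g \<oplus>\<^bsub>S\<^esub> component t g"
proof -
  define f where "f = (\<lambda>g. component s g \<oplus>\<^bsub>S\<^esub> component t g)"
  define F where "F = degrees s \<union> degrees t"
  have F: "finite F" "F \<subseteq> carrier G" "degrees s \<subseteq> F" "degrees t \<subseteq> F"
    using s t finite_degrees unfolding F_def by blast+
  have "component s \<in> F \<rightarrow> carrier S" "component t \<in> F \<rightarrow> carrier S"
    using s t F(2) component_carrier by blast+
  then have "finsum S f F = finsum S (component s) F \<oplus>\<^bsub>S\<^esub> finsum S (component t) F"
    unfolding f_def by (rule finsum_addf)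
  also have "\<dots> = s \<oplus>\<^bsub>S\<^esub> t"
    by (simp only: finsum_component[OF s F(1,2,3)] finsum_component[OF t F(1,2,4)])
  finally have sum: "finsum S f F = s \<oplus>\<^bsub>S\<^esub> t" .
  have "f h \<in> D h" if "h \<in> F" for h
    unfolding f_def using that F(2) s t by (intro D_add component_mem) auto
  from component_unique[OF F(1,2) this g]
  have "component (s \<oplus>\<^bsub>S\<^esub> t) g = (if g \<in> F then f g else \<zero>\<^bsub>S\<^esub>)"
    unfolding sum .
  moreover have "component s g = \<zero>\<^bsub>S\<^esub>" "component t g = \<zero>\<^bsub>S\<^esub>" if "g \<notin> F"
    using that g F(3,4) by blast+
  ultimately show ?thesis unfolding f_def by (cases "g \<in> F") simp_all
qed

lemma component_homogeneous:
  assumes "x \<in> D h" "h \<in> carrier G" "g \<in> carrier G"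
  shows "component x g = (if g = h then x else \<zero>\<^bsub>S\<^esub>)"
proof -
  have "finsum S (\<lambda>_. x) {h} = x" using D_carrier[OF assms(1,2)] by simp
  then show ?thesis using component_unique[of "{h}" "\<lambda>_. x" g] assms by auto
qed

lemma component_finsum:
  assumes "f \<in> A \<rightarrow> carrier S" "g \<in> carrier G" 
  shows "component (finsum S f A) g = finsum S (\<lambda>i. component (f i) g) A"
  using assms(1)
proof (induction A rule: infinite_finite_induct)
  case (insert i A)
  then have "\<And>j. j \<in> A \<Longrightarrow> f j \<in> carrier S" "f i \<in> carrier S"
    by auto
  with insert.hyps insert.IH assms(2) show ?case by (simp add: component_add Pi_iff)
\<comment> \<open>For an infinite index set \<open>finsum\<close> is zero by convention, so both
  sides vanish.\<close>
qed (use assms(2) in \<open>simp_all add: component_homogeneous[OF D_zero[OF assms(2)] assms(2)]\<close>)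

lemma homogeneous_induct [consumes 1, case_names homogeneous add]:
  assumes "s \<in> carrier S"
    and "\<And>g x. \<lbrakk>g \<in> carrier G; x \<in> D g\<rbrakk> \<Longrightarrow> Q x"
    and "\<And>x y. \<lbrakk>x \<in> carrier S; y \<in> carrier S; Q x; Q y\<rbrakk> \<Longrightarrow> Q (x \<oplus>\<^bsub>S\<^esub> y)"
  shows "Q s"
proof -
  have "Q (finsum S (component s) F)" if "finite F" "F \<subseteq> carrier G" for F
    using that
  proof induction
    case empty
    \<comment> \<open>The empty sum needs no case of its own: zero is homogeneous of the identity
      degree.\<close>
    show ?case using assms(2)[OF G_closed(1) D_zero[OF G_closed(1)]] by simp
  next
    case (insert g F)
    then have "component s \<in> F \<rightarrow> carrier S" using assms(1) by auto
    then have "finsum S (component s) F \<in> carrier S" by simp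
    moreover have "finsum S (component s) (insert g F) = component s g \<oplus>\<^bsub>S\<^esub> finsum S (component s) F"
      using insert assms(1) by (auto intro!: finsum_insert)
    ultimately show ?case
      using insert assms(3) assms(2)[OF _ component_mem] assms(1) by auto
  qed
  from this[of "degrees s"] show ?thesis
    using assms(1) finite_degrees by (simp add: finsum_component)
qed

text \<open>Left multiplication by an element of degree \<open>k\<close> translates degrees by
  \<open>k\<close>. Both sides are additive in \<open>s\<close>, so homogeneous \<open>s\<close>
  suffice.\<close>

lemma component_mult_left:
  assumes "s \<in> carrier S" and r: "r \<in> D k" and k: "k \<in> carrier G" and h: "h \<in> carrier G"
  shows "component (r \<otimes>\<^bsub>S\<^esub> s) h = r \<otimes>\<^bsub>S\<^esub> component s (inv\<^bsub>G\<^esub> k \<otimes>\<^bsub>G\<^esub> h)"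
  using assms(1)
proof (induction s rule: homogeneous_induct)
  case (homogeneous g x)
  then have "h = k \<otimes>\<^bsub>G\<^esub> g \<longleftrightarrow> inv\<^bsub>G\<^esub> k \<otimes>\<^bsub>G\<^esub> h = g"
    using k h by (metis group.inv_solve_left[OF group_axioms])
  then show ?case
    using homogeneous r k h D_mult[of r k x g] D_carrier[OF r k]
    by (simp add: component_homogeneous)
next
  case (add x y)
  then show ?case using k h D_carrier[OF r k] by (simp add: r_distr component_add)
qed

lemma component_mult_right:
  assumes "s \<in> carrier S" and r: "r \<in> D k" and k: "k \<in> carrier G" and h: "h \<in> carrier G"
  shows "component (s \<otimes>\<^bsub>S\<^esub> r) h = component s (h \<otimes>\<^bsub>G\<^esub> inv\<^bsub>G\<^esub> k) \<otimes>\<^bsub>S\<^esub> r"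
  using assms(1)
proof (induction s rule: homogeneous_induct)
  case (homogeneous g x)
  then have "h = g \<otimes>\<^bsub>G\<^esub> k \<longleftrightarrow> h \<otimes>\<^bsub>G\<^esub> inv\<^bsub>G\<^esub> k = g"
    using k h by (metis group.inv_solve_right[OF group_axioms])
  then show ?case
    using homogeneous r k h D_mult[of x g r k] D_carrier[OF r k]
    by (simp add: component_homogeneous)
next
  case (add x y)
  then show ?case using k h D_carrier[OF r k] by (simp add: l_distr component_add)
qed

text \<open>Up to a shift of degree, multiplying a component by a homogeneous \<open>u\<close> gives
  a component of the full product, and \<open>P\<close> is closed under components.\<close>

lemma mult_component_mem:
  assumes P: "\<And>s g. \<lbrakk>s \<in> P; g \<in> carrier G\<rbrakk> \<Longrightarrow> component s g \<in> P"
    and "s \<in> carrier S" "u \<in> D k" "k \<in> carrier G" "h \<in> carrier G"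
  shows "u \<otimes>\<^bsub>S\<^esub> s \<in> P \<Longrightarrow> u \<otimes>\<^bsub>S\<^esub> component s h \<in> P"
    and "s \<otimes>\<^bsub>S\<^esub> u \<in> P \<Longrightarrow> component s h \<otimes>\<^bsub>S\<^esub> u \<in> P"
proof -
  show "u \<otimes>\<^bsub>S\<^esub> component s h \<in> P" if "u \<otimes>\<^bsub>S\<^esub> s \<in> P"
    using P[OF that, of "k \<otimes>\<^bsub>G\<^esub> h"] assms(2-5) component_mult_left[of s u k "k \<otimes>\<^bsub>G\<^esub> h"]
    by (simp add: G_assoc[symmetric])
  show "component s h \<otimes>\<^bsub>S\<^esub> u \<in> P" if "s \<otimes>\<^bsub>S\<^esub> u \<in> P"
    using P[OF that, of "h \<otimes>\<^bsub>G\<^esub> k"] assms(2-5) component_mult_right[of s u k "h \<otimes>\<^bsub>G\<^esub> k"]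
    by (simp add: G_assoc)
qed

lemma mem_if_components_mem:
  assumes "ideal P S" "s \<in> carrier S" "\<And>g. g \<in> carrier G \<Longrightarrow> component s g \<in> P"
  shows "s \<in> P"
proof -
  interpret P: ideal P S by fact
  have "finsum S (component s) (degrees s) \<in> P"
    by (rule P.finsum_mem[OF abelian_monoid_axioms]) (use assms(3) in blast)
  moreover have "finsum S (component s) (degrees s) = s"
    by (rule finsum_component) (use assms(2) finite_degrees in auto)
  ultimately show ?thesis by simp
qed

subsection \<open>Homogeneous ideals over unique product groups\<close>

text \<open>A failure of primeness of a homogeneous ideal is already visible on homogeneous
  elements. They are found as components of an \<open>x\<close> in \<open>A - P\<close> with the
  fewest components outside \<open>P\<close> and of an arbitrary \<open>y\<close> in
  \<open>B - P\<close>.\<close>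

lemma homogeneous_prime_witness:
  assumes upg: "unique_product_group G"
    and "ideal P S" and P_comp: "\<And>s g. \<lbrakk>s \<in> P; g \<in> carrier G\<rbrakk> \<Longrightarrow> component s g \<in> P"
    and "ideal A S" "ideal B S" and AB: "ideal_prod S A B \<subseteq> P" and "\<not> A \<subseteq> P" "\<not> B \<subseteq> P"
  obtains g h x y where "g \<in> carrier G" "h \<in> carrier G" "x \<in> D g" "y \<in> D h" "x \<notin> P" "y \<notin> P"
    and "\<And>r. r \<in> carrier S \<Longrightarrow> x \<otimes>\<^bsub>S\<^esub> (r \<otimes>\<^bsub>S\<^esub> y) \<in> P"
proof -
  interpret P: ideal P S by fact
  interpret A: ideal A S by fact
  interpret B: ideal B S by fact
  define N where "N s = {g \<in> carrier G. component s g \<notin> P}" for s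
  have finite_N: "finite (N s)" if "s \<in> carrier S" for s
    by (rule finite_subset[OF _ finite_degrees[OF that]]) (auto simp: N_def)
  obtain x0 where "x0 \<in> A - P" using \<open>\<not> A \<subseteq> P\<close> by blast
  then obtain x where x: "x \<in> A" "x \<notin> P"
    and x_min: "\<And>x'. \<lbrakk>x' \<in> A; x' \<notin> P\<rbrakk> \<Longrightarrow> card (N x) \<le> card (N x')"
    using ex_has_least_nat[of "\<lambda>x. x \<in> A - P" x0 "\<lambda>x. card (N x)"] by (metis Diff_iff)
  obtain y where y: "y \<in> B" "y \<notin> P" using \<open>\<not> B \<subseteq> P\<close> by blast
  have xS: "x \<in> carrier S" and yS: "y \<in> carrier S" using x y by simp_all
  have key: "component x g \<otimes>\<^bsub>S\<^esub> (r \<otimes>\<^bsub>S\<^esub> component y h) \<in> P"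
    if r: "r \<in> D k" and k: "k \<in> carrier G" and "g \<in> carrier G" "h \<in> carrier G" for r k g h
  proof -
    have rS: "r \<in> carrier S" using D_carrier r k .
    define X where "X = {g \<in> carrier G. component x g \<otimes>\<^bsub>S\<^esub> (r \<otimes>\<^bsub>S\<^esub> y) \<notin> P}"
    define Y where "Y = {h \<in> carrier G. x \<otimes>\<^bsub>S\<^esub> (r \<otimes>\<^bsub>S\<^esub> component y h) \<notin> P}"
    \<comment> \<open>Removing the degrees that contribute nothing modulo \<open>P\<close> isolates the unique product.\<close>
    have outside_X: "component x g \<otimes>\<^bsub>S\<^esub> (r \<otimes>\<^bsub>S\<^esub> component y h) \<in> P"
      if "g \<in> carrier G" "h \<in> carrier G" "g \<notin> X" for g h
    proof -
      have "(component x g \<otimes>\<^bsub>S\<^esub> r) \<otimes>\<^bsub>S\<^esub> y \<in> P"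
        using that xS yS rS by (simp add: X_def m_assoc)
      then have "(component x g \<otimes>\<^bsub>S\<^esub> r) \<otimes>\<^bsub>S\<^esub> component y h \<in> P"
        using that xS yS r k
        by (intro mult_component_mem(1)[OF P_comp yS D_mult[OF component_mem r]]) auto
      then show ?thesis using that xS yS rS by (simp add: m_assoc)
    qed
    have outside_Y: "component x g \<otimes>\<^bsub>S\<^esub> (r \<otimes>\<^bsub>S\<^esub> component y h) \<in> P"
      if "g \<in> carrier G" "h \<in> carrier G" "h \<notin> Y" for g h
    proof -
      have "x \<otimes>\<^bsub>S\<^esub> (r \<otimes>\<^bsub>S\<^esub> component y h) \<in> P"
        using that by (simp add: Y_def)
      then show ?thesis
        using that xS yS r k
        by (intro mult_component_mem(2)[OF P_comp xS D_mult[OF r component_mem]]) auto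
    qed
    \<comment> \<open>If either set is empty, \<open>outside_X\<close> or \<open>outside_Y\<close>
      covers every pair of degrees and \<open>key\<close> follows.\<close>
    have "X = {} \<or> Y = {}"
    proof (rule ccontr)
      assume nonempty: "\<not> (X = {} \<or> Y = {})"
      have X: "X \<subseteq> degrees x" and Y: "Y \<subseteq> degrees y"
        using xS yS rS by (auto simp: X_def Y_def)
      have "finite X" "finite Y"
        using finite_subset[OF X finite_degrees[OF xS]] finite_subset[OF Y finite_degrees[OF yS]] .
      moreover have "X \<subseteq> carrier G" "(\<otimes>\<^bsub>G\<^esub>) k ` Y \<subseteq> carrier G"
        using k by (auto simp: X_def Y_def)
      \<comment> \<open>The second set is translated by \<open>k\<close> because \<open>r\<close>
        times the component of \<open>y\<close> in degree \<open>h\<close> has degree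
        \<open>k h\<close>.\<close>
      ultimately have "\<exists>g\<in>X. \<exists>h\<in>(\<otimes>\<^bsub>G\<^esub>) k ` Y. \<forall>g'\<in>X. \<forall>h'\<in>(\<otimes>\<^bsub>G\<^esub>) k ` Y.
          (g', h') \<noteq> (g, h) \<longrightarrow> g \<otimes>\<^bsub>G\<^esub> h \<noteq> g' \<otimes>\<^bsub>G\<^esub> h'"
        using nonempty
        by (intro upg[unfolded unique_product_group_def, THEN conjunct2, rule_format]) auto
      then obtain g h where g: "g \<in> X" and h: "h \<in> Y"
        and uniq: "\<And>g' h'. \<lbrakk>g' \<in> X; h' \<in> Y; g' \<noteq> g\<rbrakk> \<Longrightarrow>
          g \<otimes>\<^bsub>G\<^esub> (k \<otimes>\<^bsub>G\<^esub> h) \<noteq> g' \<otimes>\<^bsub>G\<^esub> (k \<otimes>\<^bsub>G\<^esub> h')"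
        by blast
      have gG: "g \<in> carrier G" and hG: "h \<in> carrier G" using g h by (auto simp: X_def Y_def)
      let ?n = "g \<otimes>\<^bsub>G\<^esub> (k \<otimes>\<^bsub>G\<^esub> h)"
      \<comment> \<open>\<open>?h g'\<close> is the only degree of \<open>y\<close> that combines
        with degree \<open>g'\<close> of \<open>x\<close> and degree \<open>k\<close> of
        \<open>r\<close> to give \<open>?n\<close>.\<close>
      let ?h = "\<lambda>g'. inv\<^bsub>G\<^esub> k \<otimes>\<^bsub>G\<^esub> (inv\<^bsub>G\<^esub> g' \<otimes>\<^bsub>G\<^esub> ?n)"
      let ?f = "\<lambda>g'. component x g' \<otimes>\<^bsub>S\<^esub> (r \<otimes>\<^bsub>S\<^esub> y)"
      have comp_f: "component (?f g') ?n = component x g' \<otimes>\<^bsub>S\<^esub> (r \<otimes>\<^bsub>S\<^esub> component y (?h g'))"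
        if "g' \<in> carrier G" for g'
        using that gG hG k r rS xS yS
        by (simp add: component_mult_left[OF _ component_mem] component_mult_left[OF _ r k])
      \<comment> \<open>Expanding only \<open>x\<close> in the product \<open>x r y\<close>, which
        lies in \<open>P\<close>, writes its component of degree \<open>?n\<close> as a sum indexed
        by the degrees of \<open>x\<close>.\<close>
      have "finsum S ?f (degrees x) = finsum S (component x) (degrees x) \<otimes>\<^bsub>S\<^esub> (r \<otimes>\<^bsub>S\<^esub> y)"
        by (rule finsum_ldistr[symmetric]) (use xS yS rS finite_degrees in auto)
      also have "finsum S (component x) (degrees x) = x"
        by (rule finsum_component) (use xS finite_degrees in auto)
      finally have "finsum S ?f (degrees x) \<in> P"
        using AB x y rS ideal_prod.prod[of x A "r \<otimes>\<^bsub>S\<^esub> y" B S] B.I_l_closed by auto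
      then have "component (finsum S ?f (degrees x)) ?n \<in> P"
        using P_comp gG hG k by simp
      moreover have "component (finsum S ?f (degrees x)) ?n
          = finsum S (\<lambda>g'. component (?f g') ?n) (degrees x)"
        by (rule component_finsum) (use xS yS rS gG hG k in auto)
      ultimately have sum_mem: "finsum S (\<lambda>g'. component (?f g') ?n) (degrees x) \<in> P" by simp
      have others: "component (?f g') ?n \<in> P" if "g' \<in> degrees x" "g' \<noteq> g" for g'
      proof -
        have g': "g' \<in> carrier G" using that by simp
        have h': "?h g' \<in> carrier G" using g' gG hG k by simp
        have "g' \<otimes>\<^bsub>G\<^esub> (k \<otimes>\<^bsub>G\<^esub> ?h g') = ?n"
          using g' gG hG k by (simp add: G_assoc[symmetric])
        \<comment> \<open>The pair \<open>g'\<close>, \<open>?h g'\<close> has the same product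
          \<open>?n\<close>, so uniqueness forbids it from lying in \<open>X\<close> and
          \<open>Y\<close> simultaneously.\<close>
        then have "g' \<notin> X \<or> ?h g' \<notin> Y" using uniq[of g' "?h g'"] that by metis
        then show ?thesis
          using outside_X[OF g' h'] outside_Y[OF g' h'] comp_f[OF g'] by auto
      qed
      have "component (?f g) ?n \<in> P"
        by (rule P.finsum_mem_cancel[OF abelian_group_axioms finite_degrees[OF xS]
              subsetD[OF X g] _ sum_mem others]) (use xS yS rS gG hG k in auto)
      moreover have "?h g = h" using gG hG k by (simp add: G_assoc[symmetric])
      ultimately have gh: "component x g \<otimes>\<^bsub>S\<^esub> (r \<otimes>\<^bsub>S\<^esub> component y h) \<in> P"
        using comp_f[OF gG] by simp
      \<comment> \<open>This element contradicts minimality. It lies in \<open>A\<close> but not in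
        \<open>P\<close>, since \<open>h\<close> is in \<open>Y\<close>; its degrees outside
        \<open>P\<close> are translates of those of \<open>x\<close>, and \<open>g\<close> is lost
        by \<open>gh\<close>.\<close>
      define z where "z = x \<otimes>\<^bsub>S\<^esub> (r \<otimes>\<^bsub>S\<^esub> component y h)"
      have "z \<in> A" unfolding z_def using x rS yS hG by (intro A.I_r_closed) auto
      moreover have "z \<notin> P" using h by (simp add: Y_def z_def)
      ultimately have "card (N x) \<le> card (N z)" by (rule x_min)
      have "N z \<subseteq> (\<lambda>g'. g' \<otimes>\<^bsub>G\<^esub> (k \<otimes>\<^bsub>G\<^esub> h)) ` (N x - {g})"
      proof
        fix m assume m: "m \<in> N z"
        let ?g = "m \<otimes>\<^bsub>G\<^esub> inv\<^bsub>G\<^esub> (k \<otimes>\<^bsub>G\<^esub> h)"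
        have mG: "m \<in> carrier G" using m by (simp add: N_def)
        have "component z m = component x ?g \<otimes>\<^bsub>S\<^esub> (r \<otimes>\<^bsub>S\<^esub> component y h)"
          unfolding z_def
          by (rule component_mult_right[OF xS D_mult[OF r component_mem]]) (use yS hG k mG in auto)
        moreover have "component z m \<notin> P" using m by (simp add: N_def)
        ultimately have *: "component x ?g \<otimes>\<^bsub>S\<^esub> (r \<otimes>\<^bsub>S\<^esub> component y h) \<notin> P" by simp
        have "r \<otimes>\<^bsub>S\<^esub> component y h \<in> carrier S" using rS yS hG by simp
        then have "component x ?g \<notin> P" using * P.I_r_closed by metis
        then have "?g \<in> N x" using mG k hG by (simp add: N_def)
        moreover have "?g \<noteq> g" using * gh by auto
        moreover have "m = ?g \<otimes>\<^bsub>G\<^esub> (k \<otimes>\<^bsub>G\<^esub> h)"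
          using mG k hG by (simp add: G_assoc)
        ultimately show "m \<in> (\<lambda>g'. g' \<otimes>\<^bsub>G\<^esub> (k \<otimes>\<^bsub>G\<^esub> h)) ` (N x - {g})"
          by blast
      qed
      then have "card (N z) \<le> card (N x - {g})"
        using finite_N[OF xS] by (intro surj_card_le) auto
      also have "\<dots> < card (N x)"
      proof (rule psubset_card_mono[OF finite_N[OF xS]])
        \<comment> \<open>Membership of \<open>g\<close> in \<open>X\<close> makes the loss of
          \<open>g\<close> strict.\<close>
        have "component x g \<notin> P"
          using g P.I_r_closed[of "component x g" "r \<otimes>\<^bsub>S\<^esub> y"] rS yS by (auto simp: X_def)
        then show "N x - {g} \<subset> N x" using gG by (auto simp: N_def)
      qed
      finally show False using \<open>card (N x) \<le> card (N z)\<close> by simp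
    qed
    then show ?thesis using outside_X outside_Y that by blast
  qed
  obtain g where g: "g \<in> carrier G" "component x g \<notin> P"
    using mem_if_components_mem[OF \<open>ideal P S\<close> xS] x by blast
  obtain h where h: "h \<in> carrier G" "component y h \<notin> P"
    using mem_if_components_mem[OF \<open>ideal P S\<close> yS] y by blast
  have "component x g \<otimes>\<^bsub>S\<^esub> (r \<otimes>\<^bsub>S\<^esub> component y h) \<in> P" if "r \<in> carrier S" for r
    using that
  proof (induction r rule: homogeneous_induct)
    case (homogeneous k r)
    then show ?case using key g h by blast
  next
    case (add r s)
    then show ?case using xS yS g h by (simp add: l_distr r_distr)
  qed
  then show ?thesis using that g h component_mem xS yS by blast
qed

end

subsection \<open>Restriction and extension of invariant ideals\<close>

context strongly_graded_ring
begin

text \<open>Strong grading gives \<open>1 = sum u v\<close> with \<open>u\<close> in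
  \<open>D k\<close> and \<open>v\<close> in \<open>D (inv k)\<close>; multiply by \<open>x\<close>
  and distribute. Later arguments use strong grading in this form.\<close>

lemma mult_mem_via_unit:
  assumes "k \<in> carrier G" "x \<in> carrier S"
    and "\<And>s t. \<lbrakk>s \<in> T; t \<in> T\<rbrakk> \<Longrightarrow> s \<oplus>\<^bsub>S\<^esub> t \<in> T"
  shows "(\<And>u v. \<lbrakk>u \<in> D k; v \<in> D (inv\<^bsub>G\<^esub> k)\<rbrakk> \<Longrightarrow> x \<otimes>\<^bsub>S\<^esub> (u \<otimes>\<^bsub>S\<^esub> v) \<in> T) \<Longrightarrow> x \<in> T"
    and "(\<And>u v. \<lbrakk>u \<in> D k; v \<in> D (inv\<^bsub>G\<^esub> k)\<rbrakk> \<Longrightarrow> (u \<otimes>\<^bsub>S\<^esub> v) \<otimes>\<^bsub>S\<^esub> x \<in> T) \<Longrightarrow> x \<in> T"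
proof -
  have "\<one>\<^bsub>S\<^esub> \<in> ideal_prod S (D k) (D (inv\<^bsub>G\<^esub> k))"
    using assms(1) graded_one by (simp add: strongly_graded)
  note unit = ideal_prod_mult_mem[OF D_subset D_subset assms(2,3) this]
  show "x \<in> T" if "\<And>u v. \<lbrakk>u \<in> D k; v \<in> D (inv\<^bsub>G\<^esub> k)\<rbrakk> \<Longrightarrow> x \<otimes>\<^bsub>S\<^esub> (u \<otimes>\<^bsub>S\<^esub> v) \<in> T"
    using unit(1) that assms(1,2) by simp
  show "x \<in> T" if "\<And>u v. \<lbrakk>u \<in> D k; v \<in> D (inv\<^bsub>G\<^esub> k)\<rbrakk> \<Longrightarrow> (u \<otimes>\<^bsub>S\<^esub> v) \<otimes>\<^bsub>S\<^esub> x \<in> T"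
    using unit(2) that assms(1,2) by simp
qed

lemma ring_base_ring: "ring (base_ring G S D)"
proof -
  have "subring (D \<one>\<^bsub>G\<^esub>) S"
  proof (rule subringI)
    show "D \<one>\<^bsub>G\<^esub> \<subseteq> carrier S" by (rule D_subset) simp
    show "\<one>\<^bsub>S\<^esub> \<in> D \<one>\<^bsub>G\<^esub>" by (rule graded_one)
    show "\<ominus>\<^bsub>S\<^esub> x \<in> D \<one>\<^bsub>G\<^esub>" if "x \<in> D \<one>\<^bsub>G\<^esub>" for x
      using that additive_subgroup.a_inv_closed[OF additive_subgroup_component]
      by simp
    show "x \<otimes>\<^bsub>S\<^esub> y \<in> D \<one>\<^bsub>G\<^esub>" if "x \<in> D \<one>\<^bsub>G\<^esub>" "y \<in> D \<one>\<^bsub>G\<^esub>" for x y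
      using D_mult[OF that] by simp
    show "x \<oplus>\<^bsub>S\<^esub> y \<in> D \<one>\<^bsub>G\<^esub>" if "x \<in> D \<one>\<^bsub>G\<^esub>" "y \<in> D \<one>\<^bsub>G\<^esub>" for x y
      using D_add[OF that] by simp
  qed
  then show ?thesis unfolding base_ring_def by (rule subring_is_ring)
qed

text \<open>Conjugation stays in \<open>J\<close> by absorption and in degree \<open>e\<close> by
  counting degrees. Conversely, inserting \<open>1\<close> on both sides turns \<open>x\<close> into
  a sum of terms \<open>u' (v' x u) v\<close> whose middle factor is again in the
  restriction.\<close>

lemma invariant_ideal_restrict:
  assumes "ideal J S"
  shows "invariant_ideal G S D (J \<inter> D \<one>\<^bsub>G\<^esub>)"
proof -
  interpret J: ideal J S by fact
  interpret R: ring "base_ring G S D" by (rule ring_base_ring)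
  have [simp]: "carrier (base_ring G S D) = D \<one>\<^bsub>G\<^esub>" "mult (base_ring G S D) = mult S"
    "add (base_ring G S D) = add S" "zero (base_ring G S D) = zero S"
    "one (base_ring G S D) = one S"
    by (simp_all add: base_ring_def)
  have D1: "x \<in> carrier S" if "x \<in> D \<one>\<^bsub>G\<^esub>" for x
    using that D_carrier by simp
  let ?K = "J \<inter> D \<one>\<^bsub>G\<^esub>"
  have "ideal ?K (base_ring G S D)"
  proof (rule idealI[OF ring_base_ring])
    show "x \<otimes>\<^bsub>base_ring G S D\<^esub> a \<in> ?K" if "a \<in> ?K" "x \<in> carrier (base_ring G S D)" for a x
      using that R.m_closed[of x a] J.I_l_closed D1 by simp
    show "a \<otimes>\<^bsub>base_ring G S D\<^esub> x \<in> ?K" if "a \<in> ?K" "x \<in> carrier (base_ring G S D)" for a x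
      using that R.m_closed[of a x] J.I_r_closed D1 by simp
    show "subgroup ?K (add_monoid (base_ring G S D))"
    proof (rule R.add.subgroupI)
      show "\<ominus>\<^bsub>base_ring G S D\<^esub> a \<in> ?K" if "a \<in> ?K" for a
      proof -
        \<comment> \<open>Negation here is that of \<open>base_ring\<close>; writing it as a product
          with the negative of one reduces membership in \<open>J\<close> to absorption.\<close>
        have "\<ominus>\<^bsub>base_ring G S D\<^esub> a = (\<ominus>\<^bsub>base_ring G S D\<^esub> \<one>\<^bsub>base_ring G S D\<^esub>) \<otimes>\<^bsub>S\<^esub> a"
          using R.l_minus[OF R.one_closed, of a] R.l_one[of a] that by simp
        then show ?thesis
          using that R.a_inv_closed[of a] R.a_inv_closed[OF R.one_closed] J.I_l_closed D1 by simp
      qed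
      show "?K \<noteq> {}"
        using D_zero[OF G_closed(1)] additive_subgroup.zero_closed[OF J.is_additive_subgroup] by blast
    qed (use D_add in auto)
  qed
  moreover have "conj_ideal G S D ?K g = ?K" if g: "g \<in> carrier G" for g
  proof
    have K_add: "s \<oplus>\<^bsub>S\<^esub> t \<in> ?K" if "s \<in> ?K" "t \<in> ?K" for s t
      using that D_add by simp
    have "(u \<otimes>\<^bsub>S\<^esub> x) \<otimes>\<^bsub>S\<^esub> v \<in> ?K" if "u \<in> D g" "x \<in> ?K" "v \<in> D (inv\<^bsub>G\<^esub> g)" for u x v
    proof -
      have "u \<otimes>\<^bsub>S\<^esub> x \<in> D g" using D_mult[of u g x "\<one>\<^bsub>G\<^esub>"] that g by simp
      then have "(u \<otimes>\<^bsub>S\<^esub> x) \<otimes>\<^bsub>S\<^esub> v \<in> D \<one>\<^bsub>G\<^esub>"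
        using D_mult[of "u \<otimes>\<^bsub>S\<^esub> x" g v "inv\<^bsub>G\<^esub> g"] that g by simp
      moreover have "u \<in> carrier S" "v \<in> carrier S" using that g D_carrier by auto
      ultimately show ?thesis using that J.I_l_closed J.I_r_closed by simp
    qed
    note triple = this
    show "conj_ideal G S D ?K g \<subseteq> ?K"
      unfolding conj_ideal_def
    proof (rule ideal_prod_subset[OF _ K_add])
      fix z v assume z: "z \<in> ideal_prod S (D g) ?K" and v: "v \<in> D (inv\<^bsub>G\<^esub> g)"
      have vS: "v \<in> carrier S" using v D_carrier g by simp
      show "z \<otimes>\<^bsub>S\<^esub> v \<in> ?K"
        by (rule ideal_prod_mult_mem(2)[OF D_subset[OF g] _ vS K_add z])
          (use D1 triple[OF _ _ v] in auto)
    qed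
    show "?K \<subseteq> conj_ideal G S D ?K g"
    proof
      fix x assume x: "x \<in> ?K"
      then have xS: "x \<in> carrier S" using D1 by simp
      show "x \<in> conj_ideal G S D ?K g"
      proof (rule mult_mem_via_unit(1)[OF g xS])
        fix u v assume u: "u \<in> D g" and v: "v \<in> D (inv\<^bsub>G\<^esub> g)"
        have uS: "u \<in> carrier S" and vS: "v \<in> carrier S" using u v g D_carrier by auto
        have xu: "x \<otimes>\<^bsub>S\<^esub> u \<in> D g" using D_mult[of x "\<one>\<^bsub>G\<^esub>" u g] x u g by simp
        have "x \<otimes>\<^bsub>S\<^esub> u \<in> ideal_prod S (D g) ?K"
        proof (rule mult_mem_via_unit(2)[OF g])
          show "x \<otimes>\<^bsub>S\<^esub> u \<in> carrier S" using xS uS by simp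
          fix u' v' assume u': "u' \<in> D g" and v': "v' \<in> D (inv\<^bsub>G\<^esub> g)"
          have S': "u' \<in> carrier S" "v' \<in> carrier S" using u' v' g D_carrier by auto
          have "v' \<otimes>\<^bsub>S\<^esub> (x \<otimes>\<^bsub>S\<^esub> u) \<in> ?K"
            using D_mult[OF v' xu] x g uS S' J.I_l_closed J.I_r_closed by simp
          then have "u' \<otimes>\<^bsub>S\<^esub> (v' \<otimes>\<^bsub>S\<^esub> (x \<otimes>\<^bsub>S\<^esub> u)) \<in> ideal_prod S (D g) ?K"
            by (rule ideal_prod.prod[OF u'])
          then show "(u' \<otimes>\<^bsub>S\<^esub> v') \<otimes>\<^bsub>S\<^esub> (x \<otimes>\<^bsub>S\<^esub> u) \<in> ideal_prod S (D g) ?K"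
            using S' xS uS by (simp add: m_assoc)
        qed (rule ideal_prod.sum)
        then have "(x \<otimes>\<^bsub>S\<^esub> u) \<otimes>\<^bsub>S\<^esub> v \<in> conj_ideal G S D ?K g"
          unfolding conj_ideal_def by (rule ideal_prod.prod[OF _ v])
        then show "x \<otimes>\<^bsub>S\<^esub> (u \<otimes>\<^bsub>S\<^esub> v) \<in> conj_ideal G S D ?K g"
          using xS uS vS by (simp add: m_assoc)
      qed (simp add: conj_ideal_def ideal_prod.sum)
    qed
  qed
  ultimately show ?thesis by (simp add: invariant_ideal_def)
qed

text \<open>These facts unfold \<open>base_ring\<close> once, so that invariant ideals can be
  handled with the operations of \<open>S\<close> alone.\<close>

lemma
  assumes "invariant_ideal G S D I"
  shows invariant_ideal_subset: "I \<subseteq> D \<one>\<^bsub>G\<^esub>"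
    and invariant_ideal_zero: "\<zero>\<^bsub>S\<^esub> \<in> I"
    and invariant_ideal_add: "\<lbrakk>x \<in> I; y \<in> I\<rbrakk> \<Longrightarrow> x \<oplus>\<^bsub>S\<^esub> y \<in> I"
    and invariant_ideal_mult_right: "\<lbrakk>x \<in> I; r \<in> D \<one>\<^bsub>G\<^esub>\<rbrakk> \<Longrightarrow> x \<otimes>\<^bsub>S\<^esub> r \<in> I"
    and invariant_ideal_conj:
      "\<lbrakk>g \<in> carrier G; u \<in> D g; x \<in> I; v \<in> D (inv\<^bsub>G\<^esub> g)\<rbrakk> \<Longrightarrow> (u \<otimes>\<^bsub>S\<^esub> x) \<otimes>\<^bsub>S\<^esub> v \<in> I"
proof -
  interpret I: ideal I "base_ring G S D"
    using assms by (simp add: invariant_ideal_def)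
  show "I \<subseteq> D \<one>\<^bsub>G\<^esub>" using I.a_subset by (simp add: base_ring_def)
  show "\<zero>\<^bsub>S\<^esub> \<in> I" using additive_subgroup.zero_closed[OF I.is_additive_subgroup] by (simp add: base_ring_def)
  show "x \<oplus>\<^bsub>S\<^esub> y \<in> I" if "x \<in> I" "y \<in> I"
    using additive_subgroup.a_closed[OF I.is_additive_subgroup that] by (simp add: base_ring_def)
  show "x \<otimes>\<^bsub>S\<^esub> r \<in> I" if "x \<in> I" "r \<in> D \<one>\<^bsub>G\<^esub>"
    using I.I_r_closed[of x r] that by (simp add: base_ring_def)
  show "(u \<otimes>\<^bsub>S\<^esub> x) \<otimes>\<^bsub>S\<^esub> v \<in> I"
    if "g \<in> carrier G" "u \<in> D g" "x \<in> I" "v \<in> D (inv\<^bsub>G\<^esub> g)"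
  proof -
    have "(u \<otimes>\<^bsub>S\<^esub> x) \<otimes>\<^bsub>S\<^esub> v \<in> conj_ideal G S D I g"
      unfolding conj_ideal_def using that by (intro ideal_prod.prod)
    then show ?thesis using assms \<open>g \<in> carrier G\<close> by (simp add: invariant_ideal_def)
  qed
qed

section \<open>Extension of an invariant ideal of the base ring to an ideal of
  \<open>S\<close>\<close>

context
  fixes I assumes I: "invariant_ideal G S D I"
begin

abbreviation "IS \<equiv> ideal_prod S I (carrier S)"

lemma invariant_ideal_carrier: "x \<in> I \<Longrightarrow> x \<in> carrier S"
  using invariant_ideal_subset[OF I] D_carrier G_closed(1) by blast

lemma subset_extension: "I \<subseteq> IS"
proof
  fix x assume x: "x \<in> I"
  then have "x \<otimes>\<^bsub>S\<^esub> \<one>\<^bsub>S\<^esub> \<in> IS" by (intro ideal_prod.prod) auto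
  then show "x \<in> IS" using x invariant_ideal_carrier by simp
qed

lemma extension_carrier: "IS \<subseteq> carrier S"
  by (rule ideal_prod_carrier) (auto intro: invariant_ideal_carrier)

lemma extension_r_closed:
  assumes "z \<in> IS" "s \<in> carrier S"
  shows "z \<otimes>\<^bsub>S\<^esub> s \<in> IS"
proof (rule ideal_prod_mult_mem(2)[OF _ subset_refl assms(2) ideal_prod.sum assms(1)])
  show "I \<subseteq> carrier S" using invariant_ideal_carrier by blast
  fix i t assume "i \<in> I" "t \<in> carrier S"
  then show "(i \<otimes>\<^bsub>S\<^esub> t) \<otimes>\<^bsub>S\<^esub> s \<in> IS"
    using ideal_prod.prod[of i I "t \<otimes>\<^bsub>S\<^esub> s" "carrier S" S] assms(2) invariant_ideal_carrier
    by (simp add: m_assoc)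
qed

text \<open>By invariance, \<open>d i = d i (\<Sum> u v) = (\<Sum> (d i u) v) \<in> I S\<close> whenever
  \<open>1 = \<Sum> u v\<close> with \<open>d\<close> in degree \<open>g\<close>, \<open>u\<close> in degree \<open>g\<inverse>\<close>
  and \<open>v\<close> in degree \<open>g\<close>.\<close>

lemma extension_l_closed:
  assumes z: "z \<in> IS" and "s \<in> carrier S"
  shows "s \<otimes>\<^bsub>S\<^esub> z \<in> IS"
  using assms(2)
proof (induction s rule: homogeneous_induct)
  case (homogeneous g d)
  then have d: "d \<in> carrier S" using D_carrier by blast
  have "d \<otimes>\<^bsub>S\<^esub> i \<in> IS" if i: "i \<in> I" for i
  proof (rule mult_mem_via_unit(1)[of "inv\<^bsub>G\<^esub> g"])
    show "inv\<^bsub>G\<^esub> g \<in> carrier G" using homogeneous by simp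
    show "d \<otimes>\<^bsub>S\<^esub> i \<in> carrier S" using d i invariant_ideal_carrier by simp
    fix u v assume u: "u \<in> D (inv\<^bsub>G\<^esub> g)" and v: "v \<in> D (inv\<^bsub>G\<^esub> (inv\<^bsub>G\<^esub> g))"
    have uv: "u \<in> carrier S" "v \<in> carrier S" using u v homogeneous D_carrier by auto
    have "((d \<otimes>\<^bsub>S\<^esub> i) \<otimes>\<^bsub>S\<^esub> u) \<otimes>\<^bsub>S\<^esub> v \<in> IS"
      using invariant_ideal_conj[OF I homogeneous i u] uv(2) by (rule ideal_prod.prod)
    then show "(d \<otimes>\<^bsub>S\<^esub> i) \<otimes>\<^bsub>S\<^esub> (u \<otimes>\<^bsub>S\<^esub> v) \<in> IS"
      using d uv i invariant_ideal_carrier by (simp add: m_assoc)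
  qed (rule ideal_prod.sum)
  then have "(d \<otimes>\<^bsub>S\<^esub> i) \<otimes>\<^bsub>S\<^esub> t \<in> IS" if "i \<in> I" "t \<in> carrier S" for i t
    using that extension_r_closed by blast
  then show ?case
    using d invariant_ideal_carrier
    by (intro ideal_prod_mult_mem(1)[OF _ subset_refl d ideal_prod.sum z])
      (auto simp: m_assoc)
next
  case (add s t)
  then show ?case
    using subsetD[OF extension_carrier z] by (simp add: l_distr ideal_prod.sum)
qed

lemma ideal_extension: "ideal IS S"
proof (rule idealI[OF ring_axioms])
  show "subgroup (IS) (add_monoid S)"
  proof (rule add.subgroupI)
    show "IS \<subseteq> carrier S" by (rule extension_carrier)
    show "IS \<noteq> {}"
      using invariant_ideal_zero[OF I] subset_extension by blast
    fix a assume a: "a \<in> IS"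
    then have "a \<in> carrier S" using extension_carrier by blast
    then have "\<ominus>\<^bsub>S\<^esub> a = a \<otimes>\<^bsub>S\<^esub> \<ominus>\<^bsub>S\<^esub> \<one>\<^bsub>S\<^esub>" by (simp add: r_minus)
    then show "\<ominus>\<^bsub>S\<^esub> a \<in> IS"
      using extension_r_closed[OF a, of "\<ominus>\<^bsub>S\<^esub> \<one>\<^bsub>S\<^esub>"] by simp
  qed (simp add: ideal_prod.sum)
qed (auto intro: extension_l_closed extension_r_closed)

text \<open>\<open>I\<close> sits in degree \<open>e\<close>, so taking the component of
  \<open>i s\<close> only affects \<open>s\<close>. Hence the extension is a homogeneous
  ideal.\<close>

lemma component_extension:
  assumes "z \<in> IS" "g \<in> carrier G"
  shows "component z g \<in> IS"
  using assms(1)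
proof induction
  case (prod i s)
  have "i \<in> D \<one>\<^bsub>G\<^esub>" using prod invariant_ideal_subset[OF I] by blast
  then have "component (i \<otimes>\<^bsub>S\<^esub> s) g = i \<otimes>\<^bsub>S\<^esub> component s g"
    using component_mult_left[of s i "\<one>\<^bsub>G\<^esub>" g] prod assms(2) by simp
  then show ?case using prod assms(2) by (simp add: ideal_prod.prod)
next
  case (sum s t)
  then have "s \<in> carrier S" "t \<in> carrier S" using extension_carrier by auto
  with sum assms(2) show ?case by (simp add: component_add ideal_prod.sum)
qed

lemma extension_contract:
  assumes "z \<in> IS" "z \<in> D \<one>\<^bsub>G\<^esub>"
  shows "z \<in> I"
proof -
  \<comment> \<open>The induction runs on the component of degree \<open>e\<close>, since the
    summands of a homogeneous \<open>z\<close> need not be homogeneous.\<close>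
  have "component z \<one>\<^bsub>G\<^esub> \<in> I" using assms(1)
  proof induction
    case (prod i s)
    have "i \<in> D \<one>\<^bsub>G\<^esub>" using prod invariant_ideal_subset[OF I] by blast
    then have "component (i \<otimes>\<^bsub>S\<^esub> s) \<one>\<^bsub>G\<^esub> = i \<otimes>\<^bsub>S\<^esub> component s \<one>\<^bsub>G\<^esub>"
      using component_mult_left[of s i "\<one>\<^bsub>G\<^esub>" "\<one>\<^bsub>G\<^esub>"] prod by simp
    then show ?case using prod invariant_ideal_mult_right[OF I] component_mem by simp
  next
    case (sum s t)
    then have "s \<in> carrier S" "t \<in> carrier S" using extension_carrier by auto
    with sum show ?case by (simp add: component_add invariant_ideal_add[OF I])
  qed
  then show ?thesis using component_homogeneous[OF assms(2)] by simp
qed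

subsection \<open>The three primeness conditions\<close>

text \<open>Forwards, right multiplication by a decomposition of \<open>1\<close> removes the last
  factor of the five-fold product. Backwards, each such product lies in the extension and has degree
  \<open>e\<close>, so it contracts to \<open>I\<close>.\<close>

lemma sandwich_iff:
  assumes a: "a \<in> D \<one>\<^bsub>G\<^esub>" and b: "b \<in> D \<one>\<^bsub>G\<^esub>"
  shows "(\<forall>g\<in>carrier G. \<forall>h\<in>carrier G.
      ideal_prod S (ideal_prod S (ideal_prod S (ideal_prod S
        (D g) {a}) (D (inv\<^bsub>G\<^esub> (h \<otimes>\<^bsub>G\<^esub> g)))) {b}) (D h) \<subseteq> I)
    \<longleftrightarrow> (\<forall>s\<in>carrier S. a \<otimes>\<^bsub>S\<^esub> (s \<otimes>\<^bsub>S\<^esub> b) \<in> IS)"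
    (is "(\<forall>g\<in>_. \<forall>h\<in>_. ?prod g h \<subseteq> I) \<longleftrightarrow> _")
proof
  have aS: "a \<in> carrier S" and bS: "b \<in> carrier S" using a b D_carrier G_closed(1) by blast+
  {
    assume *: "\<forall>g\<in>carrier G. \<forall>h\<in>carrier G. ?prod g h \<subseteq> I"
    show "\<forall>s\<in>carrier S. a \<otimes>\<^bsub>S\<^esub> (s \<otimes>\<^bsub>S\<^esub> b) \<in> IS"
    proof
      fix s assume "s \<in> carrier S"
      then show "a \<otimes>\<^bsub>S\<^esub> (s \<otimes>\<^bsub>S\<^esub> b) \<in> IS"
      proof (induction s rule: homogeneous_induct)
        case (homogeneous k c)
        have cS: "c \<in> carrier S" using homogeneous D_carrier by blast
        show ?case
        proof (rule mult_mem_via_unit(1)[of "inv\<^bsub>G\<^esub> k"])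
          fix e w assume e: "e \<in> D (inv\<^bsub>G\<^esub> k)" and w: "w \<in> D (inv\<^bsub>G\<^esub> (inv\<^bsub>G\<^esub> k))"
          have S: "e \<in> carrier S" "w \<in> carrier S" using e w homogeneous D_carrier by auto
          \<comment> \<open>With \<open>g\<close> the identity and \<open>h = inv k\<close>, the
            middle degree \<open>inv (h g)\<close> is \<open>k\<close>, the degree of
            \<open>c\<close>. Here \<open>e\<close> is a ring element of degree
            \<open>inv k\<close>.\<close>
          have "(((\<one>\<^bsub>S\<^esub> \<otimes>\<^bsub>S\<^esub> a) \<otimes>\<^bsub>S\<^esub> c) \<otimes>\<^bsub>S\<^esub> b) \<otimes>\<^bsub>S\<^esub> e \<in> ?prod \<one>\<^bsub>G\<^esub> (inv\<^bsub>G\<^esub> k)"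
            by (intro ideal_prod.prod graded_one e) (use homogeneous in simp_all)
          then have "(((\<one>\<^bsub>S\<^esub> \<otimes>\<^bsub>S\<^esub> a) \<otimes>\<^bsub>S\<^esub> c) \<otimes>\<^bsub>S\<^esub> b) \<otimes>\<^bsub>S\<^esub> e \<in> I"
            using * homogeneous(1) by (meson G_closed(1,3) subsetD)
          then have "((((\<one>\<^bsub>S\<^esub> \<otimes>\<^bsub>S\<^esub> a) \<otimes>\<^bsub>S\<^esub> c) \<otimes>\<^bsub>S\<^esub> b) \<otimes>\<^bsub>S\<^esub> e) \<otimes>\<^bsub>S\<^esub> w \<in> IS"
            using S(2) by (rule ideal_prod.prod)
          then show "(a \<otimes>\<^bsub>S\<^esub> (c \<otimes>\<^bsub>S\<^esub> b)) \<otimes>\<^bsub>S\<^esub> (e \<otimes>\<^bsub>S\<^esub> w) \<in> IS"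
            using aS bS cS S by (simp add: m_assoc)
        qed (use homogeneous aS bS cS in \<open>auto intro: ideal_prod.sum\<close>)
      next
        case (add s t)
        then show ?case using aS bS by (simp add: l_distr r_distr ideal_prod.sum)
      qed
    qed
  next
    assume *: "\<forall>s\<in>carrier S. a \<otimes>\<^bsub>S\<^esub> (s \<otimes>\<^bsub>S\<^esub> b) \<in> IS"
    show "\<forall>g\<in>carrier G. \<forall>h\<in>carrier G. ?prod g h \<subseteq> I"
    proof (intro ballI)
      fix g h assume g: "g \<in> carrier G" and h: "h \<in> carrier G"
      let ?k = "inv\<^bsub>G\<^esub> (h \<otimes>\<^bsub>G\<^esub> g)"
      have gk: "g \<otimes>\<^bsub>G\<^esub> ?k \<otimes>\<^bsub>G\<^esub> h = \<one>\<^bsub>G\<^esub>"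
        using g h by (simp add: group.inv_mult_group[OF group_axioms] G_assoc[symmetric])
      have elem: "(d \<otimes>\<^bsub>S\<^esub> a) \<otimes>\<^bsub>S\<^esub> (c \<otimes>\<^bsub>S\<^esub> (b \<otimes>\<^bsub>S\<^esub> e)) \<in> I"
        if d: "d \<in> D g" and c: "c \<in> D ?k" and e: "e \<in> D h" for d c e
      proof (rule extension_contract)
        have S: "d \<in> carrier S" "c \<in> carrier S" "e \<in> carrier S"
          using d c e g h D_carrier by auto
        then have "d \<otimes>\<^bsub>S\<^esub> ((a \<otimes>\<^bsub>S\<^esub> (c \<otimes>\<^bsub>S\<^esub> b)) \<otimes>\<^bsub>S\<^esub> e) \<in> IS"
          using * by (blast intro: extension_l_closed extension_r_closed)
        then show "(d \<otimes>\<^bsub>S\<^esub> a) \<otimes>\<^bsub>S\<^esub> (c \<otimes>\<^bsub>S\<^esub> (b \<otimes>\<^bsub>S\<^esub> e)) \<in> IS"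
          using S aS bS by (simp add: m_assoc)
        have "d \<otimes>\<^bsub>S\<^esub> a \<in> D g" using D_mult[OF d a g] g by simp
        moreover have "c \<otimes>\<^bsub>S\<^esub> (b \<otimes>\<^bsub>S\<^esub> e) \<in> D (?k \<otimes>\<^bsub>G\<^esub> h)"
          using D_mult[OF c D_mult[OF b e]] g h by simp
        ultimately show "(d \<otimes>\<^bsub>S\<^esub> a) \<otimes>\<^bsub>S\<^esub> (c \<otimes>\<^bsub>S\<^esub> (b \<otimes>\<^bsub>S\<^esub> e)) \<in> D \<one>\<^bsub>G\<^esub>"
          using D_mult[of "d \<otimes>\<^bsub>S\<^esub> a" g "c \<otimes>\<^bsub>S\<^esub> (b \<otimes>\<^bsub>S\<^esub> e)" "?k \<otimes>\<^bsub>G\<^esub> h"] gk g h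
          by (simp add: G_assoc)
      qed
      have D: "D g \<subseteq> carrier S" "D ?k \<subseteq> carrier S" "D h \<subseteq> carrier S" using g h D_subset by auto
      have prods: "ideal_prod S (D g) {a} \<subseteq> carrier S"
        "ideal_prod S (ideal_prod S (D g) {a}) (D ?k) \<subseteq> carrier S"
        using D aS by (simp_all add: ideal_prod_carrier)
      note I_add = invariant_ideal_add[OF I]
      show "?prod g h \<subseteq> I"
      \<comment> \<open>The nested product is peeled from the outside, reassociating to the right,
        until \<open>elem\<close> applies.\<close>
      proof (rule ideal_prod_subset[OF _ I_add])
        fix z e assume z: "z \<in> ideal_prod S (ideal_prod S (ideal_prod S (D g) {a}) (D ?k)) {b}"
          and e: "e \<in> D h"
        have eS: "e \<in> carrier S" using e D by blast
        show "z \<otimes>\<^bsub>S\<^esub> e \<in> I"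
        proof (rule ideal_prod_mult_mem(2)[OF prods(2) _ eS I_add z])
          fix z' b' assume z': "z' \<in> ideal_prod S (ideal_prod S (D g) {a}) (D ?k)" and "b' \<in> {b}"
          have "z' \<otimes>\<^bsub>S\<^esub> (b \<otimes>\<^bsub>S\<^esub> e) \<in> I"
          proof (rule ideal_prod_mult_mem(2)[OF prods(1) D(2) _ I_add z'])
            fix z'' c assume z'': "z'' \<in> ideal_prod S (D g) {a}" and c: "c \<in> D ?k"
            have cS: "c \<in> carrier S" using c D by blast
            have "z'' \<otimes>\<^bsub>S\<^esub> (c \<otimes>\<^bsub>S\<^esub> (b \<otimes>\<^bsub>S\<^esub> e)) \<in> I"
              by (rule ideal_prod_mult_mem(2)[OF D(1) _ _ I_add z''])
                (use aS bS cS eS elem c e in auto)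
            then show "(z'' \<otimes>\<^bsub>S\<^esub> c) \<otimes>\<^bsub>S\<^esub> (b \<otimes>\<^bsub>S\<^esub> e) \<in> I"
              using subsetD[OF prods(1) z''] cS bS eS by (simp add: m_assoc)
          qed (use bS eS in simp)
          then show "(z' \<otimes>\<^bsub>S\<^esub> b') \<otimes>\<^bsub>S\<^esub> e \<in> I"
            using subsetD[OF prods(2) z'] \<open>b' \<in> {b}\<close> bS eS by (simp add: m_assoc)
        qed (use bS in simp)
      qed
    qed
  }
qed

lemma sandwich_prime_if_invariant_prime:
  assumes prime: "\<And>A B. \<lbrakk>invariant_ideal G S D A; invariant_ideal G S D B; ideal_prod S A B \<subseteq> I\<rbrakk> \<Longrightarrow>
      A \<subseteq> I \<or> B \<subseteq> I"
    and a: "a \<in> D \<one>\<^bsub>G\<^esub>" and b: "b \<in> D \<one>\<^bsub>G\<^esub>"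
    and aSb: "\<And>s. s \<in> carrier S \<Longrightarrow> a \<otimes>\<^bsub>S\<^esub> (s \<otimes>\<^bsub>S\<^esub> b) \<in> IS"
  shows "a \<in> I \<or> b \<in> I"
proof -
  interpret IS: ideal IS S by (rule ideal_extension)
  have aS: "a \<in> carrier S" and bS: "b \<in> carrier S" using a b D_carrier G_closed(1) by blast+
  let ?A = "Idl\<^bsub>S\<^esub> {a}" and ?B = "Idl\<^bsub>S\<^esub> {b}"
  have A: "ideal ?A S" and B: "ideal ?B S" using aS bS by (auto intro: genideal_ideal)
  interpret A: ideal ?A S by (rule A)
  \<comment> \<open>\<open>?L\<close> is an ideal containing \<open>a\<close>, hence it contains the
    ideal generated by \<open>a\<close>.\<close>
  let ?L = "{x \<in> carrier S. \<forall>s\<in>carrier S. x \<otimes>\<^bsub>S\<^esub> (s \<otimes>\<^bsub>S\<^esub> b) \<in> IS}"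
  have "ideal ?L S"
  proof (rule idealI[OF ring_axioms])
    show "subgroup ?L (add_monoid S)"
    proof (rule add.subgroupI)
      show "?L \<noteq> {}" using aS aSb by blast
      show "\<ominus>\<^bsub>S\<^esub> x \<in> ?L" if "x \<in> ?L" for x
        using that bS by (simp add: l_minus)
    qed (use bS in \<open>auto simp: l_distr\<close>)
    show "x \<otimes>\<^bsub>S\<^esub> y \<in> ?L" if "y \<in> ?L" "x \<in> carrier S" for x y
      using that bS by (simp add: m_assoc IS.I_l_closed)
    show "y \<otimes>\<^bsub>S\<^esub> x \<in> ?L" if y: "y \<in> ?L" and x: "x \<in> carrier S" for x y
    proof -
      have "y \<otimes>\<^bsub>S\<^esub> ((x \<otimes>\<^bsub>S\<^esub> s) \<otimes>\<^bsub>S\<^esub> b) \<in> IS" if "s \<in> carrier S" for s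
        using y x that by simp
      then show ?thesis using y x bS by (simp add: m_assoc)
    qed
  qed
  then have A_L: "?A \<subseteq> ?L" by (rule genideal_minimal) (use aS aSb in auto)
  \<comment> \<open>The same device on the other side: \<open>?M\<close> is an ideal containing
    \<open>b\<close>. Together the two inclusions put the product of the generated ideals into the
    extension.\<close>
  let ?M = "{y \<in> carrier S. \<forall>x\<in>?A. x \<otimes>\<^bsub>S\<^esub> y \<in> IS}"
  have "ideal ?M S"
  proof (rule idealI[OF ring_axioms])
    show "subgroup ?M (add_monoid S)"
    proof (rule add.subgroupI)
      have "\<zero>\<^bsub>S\<^esub> \<in> ?M"
        using A.a_Hcarr additive_subgroup.zero_closed[OF IS.is_additive_subgroup] by simp
      then show "?M \<noteq> {}" by blast
      show "\<ominus>\<^bsub>S\<^esub> y \<in> ?M" if "y \<in> ?M" for y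
        using that A.a_Hcarr by (simp add: r_minus)
    qed (use A.a_Hcarr in \<open>auto simp: r_distr\<close>)
    show "x \<otimes>\<^bsub>S\<^esub> y \<in> ?M" if "y \<in> ?M" "x \<in> carrier S" for x y
      using that A.a_Hcarr A.I_r_closed by (simp add: m_assoc[symmetric])
    show "y \<otimes>\<^bsub>S\<^esub> x \<in> ?M" if "y \<in> ?M" "x \<in> carrier S" for x y
      using that A.a_Hcarr IS.I_r_closed by (simp add: m_assoc[symmetric])
  qed
  moreover have "b \<in> ?M"
  proof -
    have "x \<otimes>\<^bsub>S\<^esub> (\<one>\<^bsub>S\<^esub> \<otimes>\<^bsub>S\<^esub> b) \<in> IS" if "x \<in> ?A" for x
      using that A_L by blast
    then show ?thesis using bS by simp
  qed
  ultimately have B_M: "?B \<subseteq> ?M" by (intro genideal_minimal) auto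
  let ?A1 = "?A \<inter> D \<one>\<^bsub>G\<^esub>" and ?B1 = "?B \<inter> D \<one>\<^bsub>G\<^esub>"
  have "ideal_prod S ?A1 ?B1 \<subseteq> I"
  proof (rule ideal_prod_subset[OF _ invariant_ideal_add[OF I]])
    fix x y assume x: "x \<in> ?A1" and y: "y \<in> ?B1"
    have "x \<otimes>\<^bsub>S\<^esub> y \<in> D \<one>\<^bsub>G\<^esub>" using D_mult[of x "\<one>\<^bsub>G\<^esub>" y "\<one>\<^bsub>G\<^esub>"] x y by simp
    moreover have "x \<otimes>\<^bsub>S\<^esub> y \<in> IS" using x y B_M by blast
    ultimately show "x \<otimes>\<^bsub>S\<^esub> y \<in> I" by (intro extension_contract)
  qed
  then have "?A1 \<subseteq> I \<or> ?B1 \<subseteq> I"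
    by (intro prime invariant_ideal_restrict A B)
  moreover have "a \<in> ?A1" "b \<in> ?B1" using a b aS bS by (auto intro: genideal_self')
  ultimately show ?thesis by blast
qed

text \<open>Homogeneous witnesses of a failure of primeness are shifted to degree \<open>e\<close>
  by factors \<open>u\<close> and \<open>v\<close> that keep them outside the extension, where
  \<open>prime\<close> rules them out.\<close>

lemma S_prime_if_sandwich_prime:
  assumes upg: "unique_product_group G" and proper: "I \<noteq> D \<one>\<^bsub>G\<^esub>"
    and prime: "\<And>a b. \<lbrakk>a \<in> D \<one>\<^bsub>G\<^esub>; b \<in> D \<one>\<^bsub>G\<^esub>;
      \<And>s. s \<in> carrier S \<Longrightarrow> a \<otimes>\<^bsub>S\<^esub> (s \<otimes>\<^bsub>S\<^esub> b) \<in> IS\<rbrakk> \<Longrightarrow> a \<in> I \<or> b \<in> I"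
  shows "S_prime S I"
  unfolding S_prime_def prime_ideal_def
proof (intro conjI allI impI)
  show "ideal IS S" by (rule ideal_extension)
  show "IS \<noteq> carrier S"
  proof
    assume "IS = carrier S"
    then have "D \<one>\<^bsub>G\<^esub> \<subseteq> I"
      using extension_contract D_carrier G_closed(1) by blast
    then show False using proper invariant_ideal_subset[OF I] by blast
  qed
next
  fix A B assume AB: "ideal A S" "ideal B S" "ideal_prod S A B \<subseteq> IS"
  show "A \<subseteq> IS \<or> B \<subseteq> IS"
  proof (rule ccontr)
    assume "\<not> (A \<subseteq> IS \<or> B \<subseteq> IS)"
    then obtain g h x y where g: "g \<in> carrier G" and h: "h \<in> carrier G"
      and x: "x \<in> D g" "x \<notin> IS" and y: "y \<in> D h" "y \<notin> IS"
      and xSy: "\<And>r. r \<in> carrier S \<Longrightarrow> x \<otimes>\<^bsub>S\<^esub> (r \<otimes>\<^bsub>S\<^esub> y) \<in> IS"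
      using homogeneous_prime_witness[OF upg ideal_extension component_extension AB] by metis
    have xS: "x \<in> carrier S" and yS: "y \<in> carrier S" using x y g h D_carrier by auto
    obtain u where u: "u \<in> D (inv\<^bsub>G\<^esub> g)" and xu: "x \<otimes>\<^bsub>S\<^esub> u \<notin> IS"
    proof (rule ccontr)
      assume no_u: "\<not> thesis"
      \<comment> \<open>If every \<open>x u\<close> were in the extension, expanding
        \<open>1\<close> as a sum of products \<open>u v\<close> would put \<open>x\<close> there
        too.\<close>
      have "x \<in> IS"
      proof (rule mult_mem_via_unit(1)[OF _ xS ideal_prod.sum])
        show "inv\<^bsub>G\<^esub> g \<in> carrier G" using g by simp
        fix u v assume u: "u \<in> D (inv\<^bsub>G\<^esub> g)" and v: "v \<in> D (inv\<^bsub>G\<^esub> (inv\<^bsub>G\<^esub> g))"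
        have "u \<in> carrier S" "v \<in> carrier S" using u v g D_carrier by auto
        moreover have "x \<otimes>\<^bsub>S\<^esub> u \<in> IS" using no_u that u by blast
        ultimately show "x \<otimes>\<^bsub>S\<^esub> (u \<otimes>\<^bsub>S\<^esub> v) \<in> IS"
          using extension_r_closed xS by (simp add: m_assoc[symmetric])
      qed
      then show False using x by simp
    qed
    obtain v where v: "v \<in> D (inv\<^bsub>G\<^esub> h)" and vy: "v \<otimes>\<^bsub>S\<^esub> y \<notin> IS"
    proof (rule ccontr)
      assume no_v: "\<not> thesis"
      have "y \<in> IS"
      proof (rule mult_mem_via_unit(2)[OF h yS ideal_prod.sum])
        fix u v assume u: "u \<in> D h" and v: "v \<in> D (inv\<^bsub>G\<^esub> h)"
        have "u \<in> carrier S" "v \<in> carrier S" using u v h D_carrier by auto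
        moreover have "v \<otimes>\<^bsub>S\<^esub> y \<in> IS" using no_v that v by blast
        ultimately show "(u \<otimes>\<^bsub>S\<^esub> v) \<otimes>\<^bsub>S\<^esub> y \<in> IS"
          using extension_l_closed yS by (simp add: m_assoc)
      qed
      then show False using y by simp
    qed
    have uS: "u \<in> carrier S" and vS: "v \<in> carrier S" using u v g h D_carrier by auto
    have "x \<otimes>\<^bsub>S\<^esub> u \<in> I \<or> v \<otimes>\<^bsub>S\<^esub> y \<in> I"
    proof (rule prime)
      show "x \<otimes>\<^bsub>S\<^esub> u \<in> D \<one>\<^bsub>G\<^esub>" using D_mult[OF x(1) u] g by simp
      show "v \<otimes>\<^bsub>S\<^esub> y \<in> D \<one>\<^bsub>G\<^esub>" using D_mult[OF v y(1)] h by simp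
      fix s assume s: "s \<in> carrier S"
      \<comment> \<open>The shifting factors are absorbed into the arbitrary middle element of
        \<open>xSy\<close>.\<close>
      have "x \<otimes>\<^bsub>S\<^esub> ((u \<otimes>\<^bsub>S\<^esub> (s \<otimes>\<^bsub>S\<^esub> v)) \<otimes>\<^bsub>S\<^esub> y) \<in> IS"
        using uS vS s by (intro xSy) simp
      then show "(x \<otimes>\<^bsub>S\<^esub> u) \<otimes>\<^bsub>S\<^esub> (s \<otimes>\<^bsub>S\<^esub> (v \<otimes>\<^bsub>S\<^esub> y)) \<in> IS"
        using xS yS uS vS s by (simp add: m_assoc)
    qed
    then show False using xu vy subset_extension by blast
  qed
qed

end

text \<open>The product of the extensions of \<open>A\<close> and \<open>B\<close> lies in the
  extension of \<open>A B\<close>, so primeness applies to them, and contraction to degree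
  \<open>e\<close> returns to \<open>A\<close> or \<open>B\<close>.\<close>

lemma S_prime_imp_invariant_prime:
  assumes "S_prime S I" and I: "invariant_ideal G S D I"
    and A: "invariant_ideal G S D A" and B: "invariant_ideal G S D B"
    and AB: "ideal_prod S A B \<subseteq> I"
  shows "A \<subseteq> I \<or> B \<subseteq> I"
proof -
  let ?P = "ideal_prod S I (carrier S)" and ?A = "ideal_prod S A (carrier S)" and ?B = "ideal_prod S B (carrier S)"
  have "ideal_prod S ?A ?B \<subseteq> ?P"
  proof (rule ideal_prod_subset[OF _ ideal_prod.sum])
    fix x y assume x: "x \<in> ?A" and y: "y \<in> ?B"
    have yS: "y \<in> carrier S" using extension_carrier[OF B] y by blast
    have AS: "A \<subseteq> carrier S" "B \<subseteq> carrier S" using invariant_ideal_carrier A B by blast+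
    show "x \<otimes>\<^bsub>S\<^esub> y \<in> ?P"
    proof (rule ideal_prod_mult_mem(2)[OF AS(1) subset_refl yS ideal_prod.sum x])
      fix i s assume i: "i \<in> A" and s: "s \<in> carrier S"
      have iS: "i \<in> carrier S" using AS i by blast
      \<comment> \<open>Invariance of \<open>B\<close> enters here: its extension absorbs the
        \<open>s\<close> standing between the factors from \<open>A\<close> and
        \<open>B\<close>.\<close>
      have sy: "s \<otimes>\<^bsub>S\<^esub> y \<in> ?B" by (rule extension_l_closed[OF B y s])
      have "i \<otimes>\<^bsub>S\<^esub> (s \<otimes>\<^bsub>S\<^esub> y) \<in> ?P"
      proof (rule ideal_prod_mult_mem(1)[OF AS(2) subset_refl iS ideal_prod.sum sy])
        fix j t assume j: "j \<in> B" and t: "t \<in> carrier S"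
        have "(i \<otimes>\<^bsub>S\<^esub> j) \<otimes>\<^bsub>S\<^esub> t \<in> ?P"
          using ideal_prod.prod[OF i j] AB t by (blast intro: ideal_prod.prod)
        then show "i \<otimes>\<^bsub>S\<^esub> (j \<otimes>\<^bsub>S\<^esub> t) \<in> ?P" using iS j AS t by (simp add: m_assoc subsetD)
      qed
      then show "(i \<otimes>\<^bsub>S\<^esub> s) \<otimes>\<^bsub>S\<^esub> y \<in> ?P" using iS s yS by (simp add: m_assoc)
    qed
  qed
  then have "?A \<subseteq> ?P \<or> ?B \<subseteq> ?P"
    using assms(1) ideal_extension[OF A] ideal_extension[OF B]
    unfolding S_prime_def prime_ideal_def by blast
  then show ?thesis
    using subset_extension[OF A] subset_extension[OF B]
      invariant_ideal_subset[OF A] invariant_ideal_subset[OF B] extension_contract[OF I] by blast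
qed

end

text \<open>Properness of \<open>I\<close> reflects that prime ideals are proper: for
  \<open>I = carrier R\<close> the second and third conditions hold trivially, while the extension
  is all of \<open>S\<close>.\<close>

theorem proposition3p2:
  fixes G :: "('g, 'm) monoid_scheme" and S :: "('s, 'n) ring_scheme"
    and D :: "'g \<Rightarrow> 's set" and R :: "('s, 'n) ring_scheme" and I :: "'s set"
  assumes "unique_product_group G"
    and "strongly_graded_ring G S D"
    and "R = base_ring G S D"
    and "invariant_ideal G S D I"
    and "I \<noteq> carrier R"
  shows "(S_prime S I \<longleftrightarrow>
            (\<forall>a\<in>carrier R. \<forall>b\<in>carrier R.
               (\<forall>g\<in>carrier G. \<forall>h\<in>carrier G.
                  ideal_prod S (ideal_prod S (ideal_prod S (ideal_prod S
                    (D g) {a}) (D (inv\<^bsub>G\<^esub> (h \<otimes>\<^bsub>G\<^esub> g)))) {b}) (D h) \<subseteq> I)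
               \<longrightarrow> a \<in> I \<or> b \<in> I))
       \<and> ((\<forall>a\<in>carrier R. \<forall>b\<in>carrier R.
               (\<forall>g\<in>carrier G. \<forall>h\<in>carrier G.
                  ideal_prod S (ideal_prod S (ideal_prod S (ideal_prod S
                    (D g) {a}) (D (inv\<^bsub>G\<^esub> (h \<otimes>\<^bsub>G\<^esub> g)))) {b}) (D h) \<subseteq> I)
               \<longrightarrow> a \<in> I \<or> b \<in> I)
            \<longleftrightarrow>
            (\<forall>A B. invariant_ideal G S D A \<longrightarrow> invariant_ideal G S D B \<longrightarrow>
               ideal_prod R A B \<subseteq> I \<longrightarrow> A \<subseteq> I \<or> B \<subseteq> I))"
    (is "(?one \<longleftrightarrow> ?two) \<and> (?two \<longleftrightarrow> ?three)")
proof -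
  interpret strongly_graded_ring G S D by fact
  note I = \<open>invariant_ideal G S D I\<close>
  have R: "carrier R = D \<one>\<^bsub>G\<^esub>" "mult R = mult S" "add R = add S"
    using \<open>R = base_ring G S D\<close> by (simp_all add: base_ring_def)
  \<comment> \<open>\<open>R\<close> and \<open>S\<close> differ only in their carrier, and
    \<open>ideal_prod\<close> depends only on addition and multiplication.\<close>
  have prod_R: "ideal_prod R A B = ideal_prod S A B" for A B
  proof
    show "ideal_prod R A B \<subseteq> ideal_prod S A B"
      by (rule ideal_prod_subset) (simp_all add: R ideal_prod.prod ideal_prod.sum)
    show "ideal_prod S A B \<subseteq> ideal_prod R A B"
      by (rule ideal_prod_subset)
        (use ideal_prod.prod[of _ A _ B R] ideal_prod.sum[of _ R A B] in \<open>simp_all add: R\<close>)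
  qed
  have two: "?two \<longleftrightarrow> (\<forall>a\<in>D \<one>\<^bsub>G\<^esub>. \<forall>b\<in>D \<one>\<^bsub>G\<^esub>.
      (\<forall>s\<in>carrier S. a \<otimes>\<^bsub>S\<^esub> (s \<otimes>\<^bsub>S\<^esub> b) \<in> ideal_prod S I (carrier S)) \<longrightarrow> a \<in> I \<or> b \<in> I)"
    by (simp only: R sandwich_iff[OF I] cong: ball_cong)
  have "?one \<Longrightarrow> ?three"
    unfolding prod_R using S_prime_imp_invariant_prime[OF _ I] by blast
  moreover have "?three \<Longrightarrow> ?two"
    unfolding prod_R two using sandwich_prime_if_invariant_prime[OF I] by blast
  moreover have "?two \<Longrightarrow> ?one"
    unfolding two using S_prime_if_sandwich_prime[OF I] assms(1,5) R(1) by metis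
  ultimately show ?thesis by blast
qed

end
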